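(* Let $\mathcal{I}\subseteq\mathcal{P}(\mathbb{N})$ be a (lightface) $\Pi^1_1$ ideal on $\mathbb{N}$, and let $A\subseteq\mathcal{N}$ be a (lightface) $\Sigma^1_1$ set. Then exactly one of the following two claims holds: (I) $A$ is $\sigma$-$\mathcal{I}$-small; (II) $A$ is $\mathcal{I}$-positive.
   Context: $\mathcal{N}=\mathbb{N}^{\mathbb{N}}$ is the Baire space; $\mathcal{P}(\mathbb{N})$ is identified with $2^{\mathbb{N}}$ for the definability of $\mathcal{I}$. A tree is a set $T\subseteq\mathbb{N}^{<\omega}$ closed under initial segments; $[T]=\{x\in\mathcal{N}:\forall m\,(x\restriction m\in T)\}$. For $s\in T$ let $\mathrm{Succ}_T(s)=\{n : s^\frown n\in T\}$; $s$ is a branching point of $T$ if $\mathrm{Succ}_T(s)$ has at least two elements. $T$ is perfect if every $s\in T$ has a branching point $t\in T$ with $s\subsetneq t$. A tree $T$ is $\mathcal{I}$-small if $\mathrm{Succ}_T(s)\in\mathcal{I}$ for every $s\in T$; it is $\mathcal{I}$-positive if it is perfect and $\mathrm{Succ}_T(s)\notin\mathcal{I}$ for every branching point $s$ of $T$. A set $X\subseteq\mathcal{N}$ is $\mathcal{I}$-small if the tree $\{x\restriction n: n\in\mathbb{N}, x\in X\}$ is $\mathcal{I}$-small; $\sigma$-$\mathcal{I}$-small if it is a countable union of $\mathcal{I}$-small sets; and $\mathcal{I}$-positive if it contains a subset of the form $[T]$ for some $\mathcal{I}$-positive tree $T$. *)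

theory Defs
  imports Main "HOL-Library.Nat_Bijection" "HOL-Library.Sublist" "HOL-Library.Countable_Set"
begin

(* Partial recursive functions. Arities are not tracked by the syntax: a program may be run on
   argument lists of any length, and it diverges on a list that is too short for it. *)

datatype recf =
    Zero
  | Succ
  | Proj nat
  | Comp recf "recf list"
  | PrimRec recf recf
  | Mu recf

inductive computes :: "recf \<Rightarrow> nat list \<Rightarrow> nat \<Rightarrow> bool" where
  zero: "computes Zero xs 0"
| succ: "computes Succ (x # xs) (Suc x)"
| proj: "i < length xs \<Longrightarrow> computes (Proj i) xs (xs ! i)"
| comp: "list_all2 (\<lambda>g y. computes g xs y) gs ys \<Longrightarrow> computes f ys z
    \<Longrightarrow> computes (Comp f gs) xs z"
| prim_0: "computes f xs y \<Longrightarrow> computes (PrimRec f g) (0 # xs) y"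
| prim_Suc: "computes (PrimRec f g) (n # xs) r \<Longrightarrow> computes g (n # r # xs) y
    \<Longrightarrow> computes (PrimRec f g) (Suc n # xs) y"
| mu: "computes f (n # xs) 0 \<Longrightarrow> \<forall>m<n. \<exists>k. computes f (m # xs) (Suc k)
    \<Longrightarrow> computes (Mu f) xs n"

definition recursively_enumerable2 :: "(nat \<Rightarrow> nat \<Rightarrow> bool) \<Rightarrow> bool" where
  "recursively_enumerable2 W \<longleftrightarrow> (\<exists>f. \<forall>a b. W a b \<longleftrightarrow> (\<exists>v. computes f [a, b] v))"

definition restr :: "(nat \<Rightarrow> nat) \<Rightarrow> nat \<Rightarrow> nat list" where
  "restr x n = map x [0..<n]"

(* Lightface Sigma^0_1 subsets of the product of two copies of the Baire space: unions of
   recursively enumerable families of basic open rectangles N_s x N_t, where N_s is the set of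
   all x extending s and finite sequences are coded by numbers via list_encode. *)

definition Sigma01 :: "((nat \<Rightarrow> nat) \<times> (nat \<Rightarrow> nat)) set \<Rightarrow> bool" where
  "Sigma01 G \<longleftrightarrow> (\<exists>W. recursively_enumerable2 W \<and>
     G = {(x, y). \<exists>s t. W (list_encode s) (list_encode t) \<and>
                        restr x (length s) = s \<and> restr y (length t) = t})"

definition Pi01 :: "((nat \<Rightarrow> nat) \<times> (nat \<Rightarrow> nat)) set \<Rightarrow> bool" where
  "Pi01 C \<longleftrightarrow> Sigma01 (- C)"

definition Sigma11 :: "(nat \<Rightarrow> nat) set \<Rightarrow> bool" where
  "Sigma11 A \<longleftrightarrow> (\<exists>C. Pi01 C \<and> A = {x. \<exists>y. (x, y) \<in> C})"

definition Pi11 :: "(nat \<Rightarrow> nat) set \<Rightarrow> bool" where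
  "Pi11 A \<longleftrightarrow> Sigma11 (- A)"

(* Sets of naturals are identified with points of the Cantor space via characteristic functions.
   The lightface Pi^1_1 subsets of the Cantor space are the traces on it of the lightface Pi^1_1
   subsets of the Baire space. *)

definition char_fun :: "nat set \<Rightarrow> nat \<Rightarrow> nat" where
  "char_fun X n = of_bool (n \<in> X)"

definition Pi11_family :: "nat set set \<Rightarrow> bool" where
  "Pi11_family I \<longleftrightarrow> (\<exists>B. Pi11 B \<and> I = {X. char_fun X \<in> B})"

(* As usual for ideals on the natural numbers, all finite sets are required to be members.
   Properness is not required, so the improper ideal UNIV is admitted as well. *)

definition ideal_on_nat :: "nat set set \<Rightarrow> bool" where
  "ideal_on_nat I \<longleftrightarrow>
     (\<forall>X. finite X \<longrightarrow> X \<in> I) \<and>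
     (\<forall>X\<in>I. \<forall>Y. Y \<subseteq> X \<longrightarrow> Y \<in> I) \<and>
     (\<forall>X\<in>I. \<forall>Y\<in>I. X \<union> Y \<in> I)"

definition is_tree :: "nat list set \<Rightarrow> bool" where
  "is_tree T \<longleftrightarrow> (\<forall>t\<in>T. \<forall>s. prefix s t \<longrightarrow> s \<in> T)"

definition branches :: "nat list set \<Rightarrow> (nat \<Rightarrow> nat) set" where
  "branches T = {x. \<forall>m. restr x m \<in> T}"

definition succs :: "nat list set \<Rightarrow> nat list \<Rightarrow> nat set" where
  "succs T s = {n. s @ [n] \<in> T}"

definition branching_point :: "nat list set \<Rightarrow> nat list \<Rightarrow> bool" where
  "branching_point T s \<longleftrightarrow> s \<in> T \<and> (\<exists>m\<in>succs T s. \<exists>n\<in>succs T s. m \<noteq> n)"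

(* The empty tree satisfies the other two clauses vacuously and has no branches; were it perfect,
   every subset of the Baire space would be positive. *)

definition perfect_tree :: "nat list set \<Rightarrow> bool" where
  "perfect_tree T \<longleftrightarrow> is_tree T \<and> T \<noteq> {} \<and>
     (\<forall>s\<in>T. \<exists>t\<in>T. branching_point T t \<and> strict_prefix s t)"

definition small_tree :: "nat set set \<Rightarrow> nat list set \<Rightarrow> bool" where
  "small_tree I T \<longleftrightarrow> is_tree T \<and> (\<forall>s\<in>T. succs T s \<in> I)"

definition positive_tree :: "nat set set \<Rightarrow> nat list set \<Rightarrow> bool" where
  "positive_tree I T \<longleftrightarrow> perfect_tree T \<and> (\<forall>s. branching_point T s \<longrightarrow> succs T s \<notin> I)"

definition tree_of :: "(nat \<Rightarrow> nat) set \<Rightarrow> nat list set" where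
  "tree_of X = {restr x n | x n. x \<in> X}"

definition small_set :: "nat set set \<Rightarrow> (nat \<Rightarrow> nat) set \<Rightarrow> bool" where
  "small_set I X \<longleftrightarrow> small_tree I (tree_of X)"

definition sigma_small_set :: "nat set set \<Rightarrow> (nat \<Rightarrow> nat) set \<Rightarrow> bool" where
  "sigma_small_set I X \<longleftrightarrow> (\<exists>F. countable F \<and> (\<forall>Y\<in>F. small_set I Y) \<and> X = \<Union>F)"

definition positive_set :: "nat set set \<Rightarrow> (nat \<Rightarrow> nat) set \<Rightarrow> bool" where
  "positive_set I X \<longleftrightarrow> (\<exists>T. positive_tree I T \<and> branches T \<subseteq> X)"

end

theory Submission
  imports Defs
begin

text \<open>
  Write \<open>A\<close> as the projection of a closed set \<open>C\<close> and call a pair of sequences \<open>(s, u)\<close> good if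
  the projection of \<open>C \<inter> (N\<^sub>s \<times> N\<^sub>u)\<close> is not \<open>\<sigma>\<close>-\<open>I\<close>-small. If \<open>(s, u)\<close> is good, then
  some \<open>t\<close> extending \<open>s\<close> has \<open>I\<close>-positively many \<open>n\<close> for which \<open>(t\<^sup>\<frown>n, u')\<close> is good for some
  \<open>u'\<close> extending \<open>u\<close>: otherwise, after discarding the countably many \<open>\<sigma>\<close>-\<open>I\<close>-small pieces, what
  is left of the projection is \<open>I\<close>-small. Iterating this from the empty pair builds a positive tree
  along with witnesses \<open>u\<close>, which converge along every branch because \<open>C\<close> is closed.
  The two alternatives exclude each other by diagonalising, inside a positive tree, against
  countably many small sets.
\<close>

section \<open>Initial segments and limits of chains of finite sequences\<close>

lemma length_restr [simp]: "length (restr x n) = n"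
  by (simp add: restr_def)

lemma nth_restr [simp]: "i < n \<Longrightarrow> restr x n ! i = x i"
  by (simp add: restr_def)

lemma restr_0 [simp]: "restr x 0 = []"
  by (simp add: restr_def)

lemma restr_Suc: "restr x (Suc n) = restr x n @ [x n]"
  by (simp add: restr_def)

lemma take_restr: "m \<le> n \<Longrightarrow> take m (restr x n) = restr x m"
  by (simp add: restr_def take_map)

lemma prefix_restr: "m \<le> n \<Longrightarrow> prefix (restr x m) (restr x n)"
  by (metis take_restr take_is_prefix)

lemma restr_eqI: "length s = n \<Longrightarrow> (\<And>i. i < n \<Longrightarrow> x i = s ! i) \<Longrightarrow> restr x n = s"
  by (rule nth_equalityI) auto

lemma restr_prefix:
  assumes "prefix s t" "restr x (length t) = t"
  shows "restr x (length s) = s"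
  using assms by (metis prefix_def append_eq_conv_conj take_restr prefix_length_le)

text \<open>The limit reads value \<open>i\<close> off \<open>s (Suc i)\<close>, which is long
  enough to have an entry there. Any two members of the chain are comparable, so they agree wherever
  both are defined.\<close>

lemma limit_of_chain:
  assumes chain: "\<And>k. prefix (s k) (s (Suc k))" and len: "\<And>k. k \<le> length (s k)"
  obtains x where "\<And>k. restr x (length (s k)) = s k"
proof -
  have mono: "prefix (s k) (s l)" if "k \<le> l" for k l
    using that by (induction l rule: dec_induct) (auto intro: prefix_order.trans chain)
  have "restr (\<lambda>i. s (Suc i) ! i) (length (s k)) = s k" for k
  proof (rule restr_eqI)
    fix i assume i: "i < length (s k)"
    have "i < length (s (Suc i))" using len[of "Suc i"] by simp
    moreover have "prefix (s k) (s (Suc i)) \<or> prefix (s (Suc i)) (s k)"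
      using mono by (meson nle_le)
    ultimately show "s (Suc i) ! i = s k ! i"
      using i by (auto simp: prefix_def nth_append)
  qed simp
  then show thesis by (rule that)
qed

lemma tree_of_iff: "s \<in> tree_of X \<longleftrightarrow> (\<exists>x\<in>X. restr x (length s) = s)"
  unfolding tree_of_def by (auto, metis)

lemma is_tree_tree_of: "is_tree (tree_of X)"
  unfolding is_tree_def by (auto simp: tree_of_iff) (metis restr_prefix)

section \<open>Closure properties of small and sigma-small sets\<close>

lemma ideal_emptyD: "ideal_on_nat I \<Longrightarrow> {} \<in> I"
  by (simp add: ideal_on_nat_def)

lemma ideal_finite: "ideal_on_nat I \<Longrightarrow> finite X \<Longrightarrow> X \<in> I"
  by (simp add: ideal_on_nat_def)

lemma ideal_subset: "ideal_on_nat I \<Longrightarrow> X \<in> I \<Longrightarrow> Y \<subseteq> X \<Longrightarrow> Y \<in> I"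
  by (auto simp: ideal_on_nat_def)

lemma small_set_subset:
  assumes "ideal_on_nat I" "small_set I X" "Y \<subseteq> X"
  shows "small_set I Y"
  unfolding small_set_def small_tree_def
proof (intro conjI ballI is_tree_tree_of)
  fix s assume "s \<in> tree_of Y"
  then have "s \<in> tree_of X" using assms(3) by (auto simp: tree_of_iff)
  then have "succs (tree_of X) s \<in> I"
    using assms(2) by (simp add: small_set_def small_tree_def)
  moreover have "succs (tree_of Y) s \<subseteq> succs (tree_of X) s"
    using assms(3) by (auto simp: succs_def tree_of_iff)
  ultimately show "succs (tree_of Y) s \<in> I"
    using assms(1) ideal_subset by blast
qed

lemma sigma_small_subset:
  assumes "ideal_on_nat I" "sigma_small_set I X" "Y \<subseteq> X"
  shows "sigma_small_set I Y"
proof -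
  obtain F where F: "countable F" "\<forall>Z\<in>F. small_set I Z" "X = \<Union>F"
    using assms(2) by (auto simp: sigma_small_set_def)
  have "small_set I (Y \<inter> Z)" if "Z \<in> F" for Z
    using small_set_subset[OF assms(1)] F(2) that by blast
  then have "countable ((\<inter>) Y ` F)" "\<forall>Z\<in>(\<inter>) Y ` F. small_set I Z" "Y = \<Union>((\<inter>) Y ` F)"
    using F(1,3) assms(3) by auto
  then show ?thesis unfolding sigma_small_set_def by blast
qed

lemma small_imp_sigma_small: "small_set I X \<Longrightarrow> sigma_small_set I X"
  unfolding sigma_small_set_def by (intro exI[of _ "{X}"]) auto

lemma sigma_small_Union:
  assumes "countable F" "\<And>X. X \<in> F \<Longrightarrow> sigma_small_set I X"
  shows "sigma_small_set I (\<Union>F)"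
proof -
  obtain G where G: "\<And>X. X \<in> F \<Longrightarrow> countable (G X) \<and> (\<forall>Y\<in>G X. small_set I Y) \<and> X = \<Union>(G X)"
    using assms(2) unfolding sigma_small_set_def by metis
  have "countable (\<Union>(G ` F))" using assms(1) G by blast
  moreover have "\<forall>Y\<in>\<Union>(G ` F). small_set I Y" using G by blast
  moreover have "\<Union>F = \<Union>(\<Union>(G ` F))"
  proof -
    have "\<Union>(\<Union>(G ` F)) = (\<Union>X\<in>F. \<Union>(G X))" by blast
    also have "\<dots> = (\<Union>X\<in>F. X)"
      by (rule SUP_cong[OF refl]) (use G in \<open>metis\<close>)
    finally show ?thesis by simp
  qed
  ultimately show ?thesis unfolding sigma_small_set_def by blast
qed

section \<open>Mutual exclusion, by diagonalisation\<close>

lemma not_sigma_small_and_positive: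
  assumes I: "ideal_on_nat I" and small: "sigma_small_set I A" and pos: "positive_set I A"
  shows False
proof -
  obtain F where F: "countable F" "\<And>Y. Y \<in> F \<Longrightarrow> small_set I Y" "A = \<Union>F"
    using small by (auto simp: sigma_small_set_def)
  obtain T where T: "perfect_tree T" "\<And>s. branching_point T s \<Longrightarrow> succs T s \<notin> I" "branches T \<subseteq> A"
    using pos by (auto simp: positive_set_def positive_tree_def)
  have tree: "\<And>s t. t \<in> T \<Longrightarrow> prefix s t \<Longrightarrow> s \<in> T" and "T \<noteq> {}"
    using T(1) unfolding perfect_tree_def is_tree_def by blast+
  then have Nil: "[] \<in> T" using Nil_prefix by blast
  have avoid: "\<exists>t. t \<in> T \<and> strict_prefix s t \<and> (Y \<in> F \<longrightarrow> t \<notin> tree_of Y)" if s: "s \<in> T" for s Y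
  proof -
    obtain t where t: "branching_point T t" "strict_prefix s t"
      using T(1) s unfolding perfect_tree_def by blast
    have "succs (tree_of Y) t \<in> I" if "Y \<in> F"
    proof (cases "t \<in> tree_of Y")
      case True
      then show ?thesis using F(2)[OF that] by (auto simp: small_set_def small_tree_def)
    next
      case False
      then have "succs (tree_of Y) t = {}"
        using is_tree_tree_of[of Y] by (auto simp: succs_def is_tree_def)
      then show ?thesis using ideal_emptyD[OF I] by simp
    qed
    then have "\<not> (Y \<in> F \<and> succs T t \<subseteq> succs (tree_of Y) t)"
      using T(2)[OF t(1)] ideal_subset[OF I] by blast
    \<comment> \<open>Provides a successor when \<open>Y\<close> is not in \<open>F\<close>.\<close>
    moreover have "succs T t \<noteq> {}" using t(1) by (auto simp: branching_point_def)
    ultimately obtain n where "t @ [n] \<in> T" "Y \<in> F \<longrightarrow> t @ [n] \<notin> tree_of Y"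
      unfolding succs_def by blast
    moreover have "strict_prefix s (t @ [n])" using t(2) by (auto simp: strict_prefix_def)
    ultimately show ?thesis by blast
  qed
  \<comment> \<open>The guard covers empty \<open>F\<close>, where \<open>from_nat_into F k\<close>
    is an arbitrary set.\<close>
  define g where "g s k = (SOME t. t \<in> T \<and> strict_prefix s t \<and>
    (from_nat_into F k \<in> F \<longrightarrow> t \<notin> tree_of (from_nat_into F k)))" for s k
  have g: "g s k \<in> T" "strict_prefix s (g s k)"
    "from_nat_into F k \<in> F \<Longrightarrow> g s k \<notin> tree_of (from_nat_into F k)" if "s \<in> T" for s k
    using someI_ex[OF avoid[OF that, of "from_nat_into F k"]] unfolding g_def by auto
  define c where "c = rec_nat [] (\<lambda>k s. g s k)"
  have c_Suc: "c (Suc k) = g (c k) k" and "c 0 = []" for k by (auto simp: c_def)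
  then have cT: "c k \<in> T" for k by (induction k) (simp_all add: Nil g(1))
  have c_prefix: "strict_prefix (c k) (c (Suc k))" for k using g(2) cT c_Suc by simp
  have c_len: "k \<le> length (c k)" for k
  proof (induction k)
    case (Suc k)
    then show ?case using prefix_length_less[OF c_prefix[of k]] by simp
  qed simp
  obtain x where x: "\<And>k. restr x (length (c k)) = c k"
    using limit_of_chain[of c] c_prefix c_len unfolding strict_prefix_def by blast
  have "restr x m \<in> T" for m
    using tree[OF cT[of m] prefix_restr[OF c_len[of m], of x, unfolded x]] .
  then have "x \<in> A" using T(3) by (auto simp: branches_def)
  then obtain Y where Y: "Y \<in> F" "x \<in> Y" using F(3) by auto
  then obtain k where "from_nat_into F k = Y" using from_nat_into_surj[OF F(1)] by blast
  \<comment> \<open>Set number \<open>k\<close> is avoided in the passage from \<open>c k\<close> to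
    \<open>c (Suc k)\<close>.\<close>
  then have "c (Suc k) \<notin> tree_of Y" using g(3)[OF cT[of k], of k] Y(1) c_Suc by simp
  then show False using Y(2) x[of "Suc k"] by (auto simp: tree_of_iff)
qed

section \<open>Sections of a plane set and positive splitting\<close>

definition sec :: "((nat \<Rightarrow> nat) \<times> (nat \<Rightarrow> nat)) set \<Rightarrow> nat list \<Rightarrow> nat list \<Rightarrow> (nat \<Rightarrow> nat) set" where
  "sec C s u = {x. \<exists>y. (x, y) \<in> C \<and> restr x (length s) = s \<and> restr y (length u) = u}"

text \<open>The length condition on \<open>u'\<close> keeps both coordinates equally long, so that
  later the two can be compared at a common length.\<close>

definition good_succs ::
  "nat set set \<Rightarrow> ((nat \<Rightarrow> nat) \<times> (nat \<Rightarrow> nat)) set \<Rightarrow> nat list \<Rightarrow> nat list \<Rightarrow> nat set" where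
  "good_succs I C t u = {n. \<exists>u'. length u' = Suc (length t) \<and> prefix u u' \<and>
     \<not> sigma_small_set I (sec C (t @ [n]) u')}"

lemma good_succs_positive:
  assumes I: "ideal_on_nat I" and len: "length s = length u"
    and not_small: "\<not> sigma_small_set I (sec C s u)"
  obtains t where "prefix s t" "good_succs I C t u \<notin> I"
proof (rule ccontr)
  assume "\<not> thesis"
  with that have neg: "\<And>t. prefix s t \<Longrightarrow> good_succs I C t u \<in> I" by blast
  \<comment> \<open>The kernel: points with a witness \<open>y\<close> along which no section ever
    becomes sigma-small.\<close>
  define Z where "Z = {x. \<exists>y. (x, y) \<in> C \<and> restr x (length s) = s \<and> restr y (length u) = u \<and>
    (\<forall>m. \<not> sigma_small_set I (sec C (restr x m) (restr y m)))}"
  have "small_set I Z"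
    unfolding small_set_def small_tree_def
  proof (intro conjI ballI is_tree_tree_of)
    fix r assume "r \<in> tree_of Z"
    then obtain z where z: "z \<in> Z" "restr z (length r) = r" by (auto simp: tree_of_iff)
    show "succs (tree_of Z) r \<in> I"
    proof (cases "length r < length s")
      case True
      \<comment> \<open>Below the length of \<open>s\<close> the tree of \<open>Z\<close> has to
        follow \<open>s\<close>.\<close>
      have "succs (tree_of Z) r \<subseteq> {s ! length r}"
      proof
        fix n assume "n \<in> succs (tree_of Z) r"
        then obtain x where x: "x \<in> Z" "restr x (Suc (length r)) = r @ [n]"
          by (auto simp: succs_def tree_of_iff)
        have "x (length r) = n" using x(2) by (simp add: restr_Suc)
        moreover have "restr x (length s) = s" using x(1) unfolding Z_def by blast
        ultimately show "n \<in> {s ! length r}" using True by (metis nth_restr singletonI)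
      qed
      then show ?thesis using ideal_finite[OF I] finite_subset by blast
    next
      case False
      have "restr z (length s) = s" using z(1) unfolding Z_def by blast
      then have "prefix s r" using prefix_restr[of "length s" "length r" z] False z(2) by simp
      moreover have "succs (tree_of Z) r \<subseteq> good_succs I C r u"
      proof
        fix n assume "n \<in> succs (tree_of Z) r"
        then obtain x where x: "x \<in> Z" "restr x (Suc (length r)) = r @ [n]"
          by (auto simp: succs_def tree_of_iff)
        then obtain y where y: "restr y (length u) = u"
            "\<And>m. \<not> sigma_small_set I (sec C (restr x m) (restr y m))"
          by (auto simp: Z_def)
        \<comment> \<open>By \<open>len\<close>, \<open>u\<close> is as long as \<open>s\<close> and
          hence no longer than \<open>r\<close>.\<close>
        have "prefix u (restr y (Suc (length r)))"
          using prefix_restr[of "length u" "Suc (length r)" y] y(1) False len by simp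
        then show "n \<in> good_succs I C r u"
          using y(2)[of "Suc (length r)"] x(2) unfolding good_succs_def
          by (auto intro!: exI[of _ "restr y (Suc (length r))"])
      qed
      ultimately show ?thesis using ideal_subset[OF I] neg by blast
    qed
  qed
  \<comment> \<open>There are only countably many pairs of finite sequences, so \<open>F\<close> is
    countable.\<close>
  moreover define F where "F = {X. sigma_small_set I X \<and> X \<in> range (\<lambda>(a, b). sec C a b)}"
  ultimately have "sigma_small_set I (\<Union>(insert Z F))"
    by (intro sigma_small_Union)
      (auto simp: small_imp_sigma_small intro: countable_subset[of _ "range (\<lambda>(a, b). sec C a b)"])
  moreover have "sec C s u \<subseteq> \<Union>(insert Z F)"
  proof
    fix x assume "x \<in> sec C s u"
    then obtain y where y: "(x, y) \<in> C" "restr x (length s) = s" "restr y (length u) = u"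
      by (auto simp: sec_def)
    show "x \<in> \<Union>(insert Z F)"
    proof (cases "\<forall>m. \<not> sigma_small_set I (sec C (restr x m) (restr y m))")
      case True
      then show ?thesis using y by (auto simp: Z_def)
    next
      case False
      then obtain m where "sigma_small_set I (sec C (restr x m) (restr y m))" by blast
      then have "sec C (restr x m) (restr y m) \<in> F" by (auto simp: F_def)
      moreover have "x \<in> sec C (restr x m) (restr y m)" using y by (auto simp: sec_def)
      ultimately show ?thesis by blast
    qed
  qed
  ultimately show False using not_small sigma_small_subset[OF I] by blast
qed

section \<open>Nodes of the fusion tree\<close>

text \<open>In \<open>node tip N w r s u\<close>, the list \<open>r\<close> is a node of the tree under construction, \<open>s\<close> is its
  longest initial segment that either is empty or immediately follows a branching point, \<open>u\<close> is the
  witness attached to \<open>s\<close>, and \<open>tip s u\<close> is the next branching point, with successor set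
  \<open>N s u\<close> and new witnesses \<open>w s u n\<close>.\<close>

inductive node :: "(nat list \<Rightarrow> nat list \<Rightarrow> nat list) \<Rightarrow> (nat list \<Rightarrow> nat list \<Rightarrow> nat set) \<Rightarrow>
    (nat list \<Rightarrow> nat list \<Rightarrow> nat \<Rightarrow> nat list) \<Rightarrow> nat list \<Rightarrow> nat list \<Rightarrow> nat list \<Rightarrow> bool"
  for tip N w where
  root: "node tip N w [] [] []"
| branch: "node tip N w (tip s u) s u \<Longrightarrow> n \<in> N s u \<Longrightarrow>
    node tip N w (tip s u @ [n]) (tip s u @ [n]) (w s u n)"
| linear: "node tip N w r s u \<Longrightarrow> prefix (r @ [n]) (tip s u) \<Longrightarrow> node tip N w (r @ [n]) s u"

text \<open>Inversion at the last entry: \<open>r\<close> is a branching point, or the path is still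
  on its way to one.\<close>

lemma node_snocE:
  assumes "node tip N w (r @ [n]) s' u'"
  obtains s u where "node tip N w r s u" "r = tip s u" "n \<in> N s u" "s' = r @ [n]" "u' = w s u n"
  | "node tip N w r s' u'" "prefix (r @ [n]) (tip s' u')"
  using assms
proof (cases rule: node.cases)
  case (branch s u m)
  then have "r = tip s u" "n = m" by simp_all
  with branch show thesis by (intro that(1)) simp_all
next
  case (linear q m)
  then have "r = q" "n = m" by simp_all
  with linear show thesis by (intro that(2)) simp_all
qed simp

text \<open>The two ways to extend \<open>r\<close> exclude each other: one needs \<open>r\<close>
  to equal its tip, the other needs the tip to be properly longer. Hence a node determines its
  data.\<close>

lemma node_unique:
  assumes "node tip N w r s u" "node tip N w r s' u'"
  shows "s = s' \<and> u = u'"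
  using assms
proof (induction r arbitrary: s u s' u' rule: rev_induct)
  case Nil
  then show ?case by (auto elim: node.cases)
next
  case (snoc n r)
  have no_overlap: False
    if "node tip N w r a b" "r = tip a b" "node tip N w r c d" "prefix (r @ [n]) (tip c d)"
    for a b c d
    using snoc.IH[OF that(1,3)] that(2,4) by auto
  from snoc.prems(1) show ?case
  proof (cases rule: node_snocE)
    case first: (1 a b)
    from snoc.prems(2) show ?thesis
    proof (cases rule: node_snocE)
      case (1 c d)
      then show ?thesis using first snoc.IH by metis
    next
      case 2
      then show ?thesis using first no_overlap by blast
    qed
  next
    case first: 2
    from snoc.prems(2) show ?thesis
    proof (cases rule: node_snocE)
      case (1 c d)
      then show ?thesis using first no_overlap by blast
    next
      case 2
      then show ?thesis using first snoc.IH by blast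
    qed
  qed
qed

lemma node_tip_aux:
  assumes "node tip N w r s u" "tip s u = r @ v"
  shows "node tip N w (tip s u) s u"
  using assms
proof (induction v arbitrary: r)
  case (Cons a v)
  then show ?case using node.linear[of tip N w r s u a] by (auto simp: prefix_def)
qed simp

section \<open>The positive tree and its branches\<close>

text \<open>Abstracts from the closed set: only the goodness of pairs and the choice of splitting
  nodes and witnesses matter for the tree.\<close>

locale branching_scheme =
  fixes I :: "nat set set" and good :: "nat list \<Rightarrow> nat list \<Rightarrow> bool"
    and tip :: "nat list \<Rightarrow> nat list \<Rightarrow> nat list" and N :: "nat list \<Rightarrow> nat list \<Rightarrow> nat set"
    and w :: "nat list \<Rightarrow> nat list \<Rightarrow> nat \<Rightarrow> nat list"
  assumes ideal: "ideal_on_nat I"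
    and good_Nil: "good [] []"
    and prefix_tip: "good s u \<Longrightarrow> prefix s (tip s u)"
    and N_notin: "good s u \<Longrightarrow> N s u \<notin> I"
    and good_step: "good s u \<Longrightarrow> n \<in> N s u \<Longrightarrow> good (tip s u @ [n]) (w s u n)"
    and prefix_w: "good s u \<Longrightarrow> n \<in> N s u \<Longrightarrow> prefix u (w s u n)"
begin

abbreviation nd where "nd \<equiv> node tip N w"

definition T where "T = {r. \<exists>s u. nd r s u}"

lemma nd_inv: "nd r s u \<Longrightarrow> good s u \<and> prefix s r \<and> prefix r (tip s u)"
proof (induction rule: node.induct)
  case root
  then show ?case using good_Nil by simp
next
  case (branch s u n)
  then show ?case using good_step prefix_tip by blast
next
  case (linear r s u n)
  then show ?case by auto
qed

lemma nd_tip: "nd r s u \<Longrightarrow> nd (tip s u) s u"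
  using nd_inv node_tip_aux by (metis prefix_def)

lemma nd_next: "nd r s u \<Longrightarrow> n \<in> N s u \<Longrightarrow> nd (tip s u @ [n]) (tip s u @ [n]) (w s u n)"
  using nd_tip node.branch by blast

text \<open>A set outside \<open>I\<close> is infinite, because \<open>I\<close> contains all finite
  sets.\<close>

lemma two_in_N:
  assumes "good s u"
  obtains m n where "m \<in> N s u" "n \<in> N s u" "m \<noteq> n"
proof -
  have "infinite (N s u)" using N_notin[OF assms] ideal_finite[OF ideal] by blast
  then obtain m where m: "m \<in> N s u" by (metis all_not_in_conv finite.emptyI)
  have "infinite (N s u - {m})" using \<open>infinite (N s u)\<close> by simp
  then obtain n where "n \<in> N s u - {m}" by (metis all_not_in_conv finite.emptyI)
  with m show thesis using that by blast
qed

lemma succs_tip: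
  assumes "nd r s u"
  shows "succs T (tip s u) = N s u"
proof
  show "N s u \<subseteq> succs T (tip s u)"
    using nd_next[OF assms] by (auto simp: succs_def T_def)
  show "succs T (tip s u) \<subseteq> N s u"
  proof
    fix n assume "n \<in> succs T (tip s u)"
    then obtain s' u' where "nd (tip s u @ [n]) s' u'" by (auto simp: succs_def T_def)
    then show "n \<in> N s u"
    proof (cases rule: node_snocE)
      case (1 a b)
      then show ?thesis using node_unique[OF nd_tip[OF assms]] by metis
    next
      case 2
      then have "s' = s \<and> u' = u" using node_unique[OF nd_tip[OF assms]] by metis
      then show ?thesis using 2(2) prefix_length_le by fastforce
    qed
  qed
qed

text \<open>Together with \<open>succs_tip\<close> this shows that the branching points are exactly
  the tips.\<close>

lemma succs_linear:
  assumes "nd r s u" "r \<noteq> tip s u" "n \<in> succs T r"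
  shows "n = tip s u ! length r"
proof -
  obtain s' u' where "nd (r @ [n]) s' u'" using assms(3) by (auto simp: succs_def T_def)
  then have "prefix (r @ [n]) (tip s u)"
    using assms(1,2) by (elim node_snocE) (metis node_unique)+
  then show ?thesis by (auto simp: prefix_def nth_append)
qed

lemma branching_point_tip:
  assumes "nd r s u"
  shows "branching_point T (tip s u)"
  using nd_tip[OF assms] two_in_N[of s u] nd_inv[OF assms]
  unfolding branching_point_def succs_tip[OF assms] by (auto simp: T_def) metis

lemma T_snocD: "r @ [n] \<in> T \<Longrightarrow> r \<in> T"
  unfolding T_def by (blast elim: node_snocE)

lemma positive_tree_T: "positive_tree I T"
  unfolding positive_tree_def perfect_tree_def
proof (intro conjI ballI allI impI)
  have "s \<in> T" if "s @ v \<in> T" for s v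
    using that by (induction v rule: rev_induct) (auto dest: T_snocD simp flip: append_assoc)
  then show "is_tree T" by (auto simp: is_tree_def prefix_def)
  show "T \<noteq> {}" using node.root[of tip N w] by (auto simp: T_def)
next
  fix r assume "r \<in> T"
  then obtain s u where r: "nd r s u" by (auto simp: T_def)
  then obtain n where n: "n \<in> N s u" using two_in_N nd_inv by metis
  let ?r = "tip s u @ [n]"
  have r': "nd ?r ?r (w s u n)" using nd_next[OF r n] .
  have "prefix r (tip s u)" "prefix ?r (tip ?r (w s u n))" using nd_inv r r' by blast+
  \<comment> \<open>The appended \<open>n\<close> makes the extension strict.\<close>
  then have "strict_prefix r (tip ?r (w s u n))"
    by (meson prefix_order.dual_order.strict_trans1 prefix_order.le_less_trans
        prefix_order.less_le_trans prefix_snocD)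
  then show "\<exists>t\<in>T. branching_point T t \<and> strict_prefix r t"
    using branching_point_tip[OF r'] by (auto simp: branching_point_def)
next
  fix r assume b: "branching_point T r"
  then obtain s u where r: "nd r s u" by (auto simp: branching_point_def T_def)
  then have "r = tip s u" using b succs_linear[OF r] by (auto simp: branching_point_def)
  then show "succs T r \<notin> I" using succs_tip[OF r] N_notin nd_inv[OF r] by simp
qed

text \<open>Up to the length of the tip the branch is forced to run along it. It then leaves through
  some element of \<open>N s u\<close>, which yields the next witness one level above the
  tip.\<close>

lemma branch_next:
  assumes x: "x \<in> branches T" and node: "nd (restr x m) s u"
  obtains m' u' where "m < m'" "nd (restr x m') (restr x m') u'" "prefix u u'"
proof -
  have inT: "\<And>k. restr x k \<in> T" using x by (simp add: branches_def)
  let ?L = "length (tip s u)"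
  have m: "m \<le> ?L" using prefix_length_le nd_inv[OF node] by fastforce
  have "nd (restr x k) s u \<and> prefix (restr x k) (tip s u)" if "m \<le> k" "k \<le> ?L" for k
    using that
  proof (induction k rule: dec_induct)
    case base
    then show ?case using node nd_inv by blast
  next
    case (step k)
    then have k: "nd (restr x k) s u" "restr x k \<noteq> tip s u" by (auto dest: arg_cong[of _ _ length])
    obtain s' u' where k': "nd (restr x k @ [x k]) s' u'"
      using inT[of "Suc k"] by (auto simp: T_def restr_Suc)
    \<comment> \<open>A change of data would need \<open>restr x k\<close> to be the tip
      already.\<close>
    then have "s' = s \<and> u' = u"
      using k by (cases rule: node_snocE) (metis node_unique)+
    with k' have "nd (restr x k @ [x k]) s u" by simp
    then show ?case using nd_inv by (simp add: restr_Suc)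
  qed
  from this[OF m order_refl] have tip: "restr x ?L = tip s u"
    by (auto simp: prefix_def) (metis append_eq_conv_conj length_restr take_all_iff order_refl)
  then have "x ?L \<in> succs T (tip s u)"
    using inT[of "Suc ?L"] by (simp add: succs_def restr_Suc)
  then have n: "x ?L \<in> N s u" using succs_tip[OF node] by simp
  have "nd (restr x (Suc ?L)) (restr x (Suc ?L)) (w s u (x ?L))"
    using nd_next[OF node n] tip by (simp add: restr_Suc)
  moreover have "prefix u (w s u (x ?L))" using prefix_w nd_inv[OF node] n by blast
  ultimately show thesis using that[of "Suc ?L"] m by simp
qed

text \<open>Iterating \<open>branch_next\<close> gives a growing chain of witnesses, and
  \<open>y\<close> is its limit.\<close>

lemma branch_witness:
  assumes x: "x \<in> branches T" and len: "\<And>s u. good s u \<Longrightarrow> length s = length u"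
  obtains y where "\<And>k. \<exists>m\<ge>k. good (restr x m) (restr y m)"
proof -
  let ?R = "\<lambda>(m, u) (m', u'). m < m' \<and> prefix u u'"
  let ?P = "\<lambda>k (m, u). nd (restr x m) (restr x m) u"
  have "\<exists>f. \<forall>k. ?P k (f k) \<and> ?R (f k) (f (Suc k))"
  proof (rule dependent_nat_choice)
    show "\<exists>p. ?P 0 p" using node.root by (intro exI[of _ "(0, [])"]) simp
  next
    fix p k assume "?P k p"
    then have "nd (restr x (fst p)) (restr x (fst p)) (snd p)" by (simp add: case_prod_beta)
    then obtain m u where "fst p < m" "nd (restr x m) (restr x m) u" "prefix (snd p) u"
      by (rule branch_next[OF x])
    then show "\<exists>q. ?P (Suc k) q \<and> ?R p q"
      by (intro exI[of _ "(m, u)"]) (simp add: case_prod_beta)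
  qed
  then obtain f where f: "\<And>k. ?P k (f k) \<and> ?R (f k) (f (Suc k))" by blast
  define m where "m k = fst (f k)" for k
  define u where "u k = snd (f k)" for k
  have nd: "nd (restr x (m k)) (restr x (m k)) (u k)" and "m k < m (Suc k)"
    and pre: "prefix (u k) (u (Suc k))" for k
    using f[of k] by (auto simp: m_def u_def case_prod_beta)
  then have "strict_mono m" by (simp add: strict_mono_Suc_iff)
  then have m: "k \<le> m k" for k by (rule strict_mono_imp_increasing)
  have good: "good (restr x (m k)) (u k)" for k using nd nd_inv by blast
  \<comment> \<open>Equal lengths identify \<open>u k\<close> with
    \<open>restr y (m k)\<close>.\<close>
  have len_u: "length (u k) = m k" for k using len[OF good[of k]] by simp
  obtain y where "\<And>k. restr y (length (u k)) = u k"
    using limit_of_chain[of u] pre m len_u by metis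
  then show thesis using that good m len_u by metis
qed

end

section \<open>Closedness and the dichotomy\<close>

text \<open>Otherwise a basic open rectangle around \<open>(x, y)\<close> misses \<open>C\<close>,
  but a point of \<open>C\<close> that agrees with \<open>(x, y)\<close> far enough lies in
  it.\<close>

lemma Sigma01_complement_limit:
  assumes "Sigma01 (- C)"
    and "\<And>k. \<exists>m\<ge>k. \<exists>x'y'\<in>C. restr (fst x'y') m = restr x m \<and> restr (snd x'y') m = restr y m"
  shows "(x, y) \<in> C"
proof (rule ccontr)
  assume "(x, y) \<notin> C"
  obtain W where W: "- C = {(x, y). \<exists>s t. W (list_encode s) (list_encode t) \<and>
      restr x (length s) = s \<and> restr y (length t) = t}"
    using assms(1) by (auto simp: Sigma01_def)
  have "(x, y) \<in> - C" using \<open>(x, y) \<notin> C\<close> by simp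
  then obtain s t where st: "W (list_encode s) (list_encode t)"
      "restr x (length s) = s" "restr y (length t) = t"
    unfolding W by auto
  obtain m x' y' where m: "m \<ge> max (length s) (length t)" "(x', y') \<in> C"
      "restr x' m = restr x m" "restr y' m = restr y m"
    using assms(2)[of "max (length s) (length t)"] by auto
  then have "restr x' (length s) = s" "restr y' (length t) = t"
    using st by (metis max.bounded_iff take_restr)+
  then have "(x', y') \<in> - C" unfolding W using st(1) by blast
  then show False using m(2) by simp
qed

lemma not_sigma_small_imp_positive:
  assumes I: "ideal_on_nat I" and A: "Sigma11 A" and not_small: "\<not> sigma_small_set I A"
  shows "positive_set I A"
proof -
  obtain C where C: "Sigma01 (- C)" and A_eq: "A = {x. \<exists>y. (x, y) \<in> C}"
    using A by (auto simp: Sigma11_def Pi01_def)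
  define good where "good s u \<longleftrightarrow> length s = length u \<and> \<not> sigma_small_set I (sec C s u)" for s u
  \<comment> \<open>These choices are meaningful only where \<open>good_succs_positive\<close>
    supplies a candidate, that is, on good pairs.\<close>
  define tip where "tip s u = (SOME t. prefix s t \<and> good_succs I C t u \<notin> I)" for s u
  define w where "w s u n = (SOME u'. length u' = Suc (length (tip s u)) \<and> prefix u u' \<and>
     \<not> sigma_small_set I (sec C (tip s u @ [n]) u'))" for s u n
  have tip: "prefix s (tip s u) \<and> good_succs I C (tip s u) u \<notin> I" if "good s u" for s u
    unfolding tip_def by (rule someI_ex) (use that good_succs_positive[OF I] in \<open>auto simp: good_def, metis\<close>)
  have w: "length (w s u n) = Suc (length (tip s u)) \<and> prefix u (w s u n) \<and>
     \<not> sigma_small_set I (sec C (tip s u @ [n]) (w s u n))"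
    if "n \<in> good_succs I C (tip s u) u" for s u n
    unfolding w_def by (rule someI_ex) (use that in \<open>auto simp: good_succs_def\<close>)
  have "sec C [] [] = A" by (auto simp: sec_def A_eq)
  then have good_Nil: "good [] []" using not_small by (simp add: good_def)
  interpret branching_scheme I good tip "\<lambda>s u. good_succs I C (tip s u) u" w
  proof
    show "good (tip s u @ [n]) (w s u n)" if "n \<in> good_succs I C (tip s u) u" for s u n
      using w[OF that] by (simp add: good_def)
  qed (use I good_Nil tip w in blast)+
  have "branches T \<subseteq> A"
  proof
    fix x assume "x \<in> branches T"
    then obtain y where y: "\<And>k. \<exists>m\<ge>k. good (restr x m) (restr y m)"
      using branch_witness[of x thesis] good_def by blast
    have "(x, y) \<in> C"
    proof (rule Sigma01_complement_limit[OF C])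
      fix k
      obtain m where m: "m \<ge> k" "good (restr x m) (restr y m)" using y by blast
      \<comment> \<open>As an empty union; so the section of a good pair contains a point.\<close>
      have "sigma_small_set I {}" using sigma_small_Union[of "{}" I] by simp
      then have "sec C (restr x m) (restr y m) \<noteq> {}" using m(2) by (auto simp: good_def)
      then obtain x' y' where "(x', y') \<in> C" "restr x' m = restr x m" "restr y' m = restr y m"
        by (auto simp: sec_def)
      then show "\<exists>m\<ge>k. \<exists>x'y'\<in>C. restr (fst x'y') m = restr x m \<and> restr (snd x'y') m = restr y m"
        using m(1) by force
    qed
    then show "x \<in> A" by (auto simp: A_eq)
  qed
  then show ?thesis using positive_tree_T by (auto simp: positive_set_def)
qed

theorem theorem17:
  fixes I :: "nat set set" and A :: "(nat \<Rightarrow> nat) set"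
  assumes "ideal_on_nat I" and "Pi11_family I" and "Sigma11 A"
  shows "(sigma_small_set I A \<or> positive_set I A) \<and>
         \<not> (sigma_small_set I A \<and> positive_set I A)"
  using assms(1,3) not_sigma_small_imp_positive not_sigma_small_and_positive by blast

end
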